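(* Let $\Omega\subset\mathbb{R}^n$ be a nonempty closed convex set and let $I\subset\{1,\dots,n\}$ be a nonempty index set such that $\pi_I(\Omega)$ is unbounded. Then: (i) $T(\infty_I;\Omega)=\mathop{\mathrm{Lim\,inf}}_{\pi_I(x)\xrightarrow{\Omega}\infty}T(x;\Omega)$; (ii) $N^M(\infty_I;\Omega)\subset N(\infty_I;\Omega)$.
   Context: $\mathbb{R}^n$ carries the Euclidean inner product and norm. For a nonempty index set $I\subset\{1,\dots,n\}$, $\pi_I(x)=(x_i)_{i\in I}$. For $x\in\Omega$ ($\Omega$ convex), the tangent cone is $T(x;\Omega)=\mathrm{cl}\,\{\lambda(y-x)\mid \lambda\ge 0,\ y\in\Omega\}$ and the normal cone is $N(x;\Omega)=\{v\mid\langle v,y-x\rangle\le 0\ \forall y\in\Omega\}$. For a set-valued map $F$, $\mathop{\mathrm{Lim\,inf}}_{\pi_I(x)\xrightarrow{\Omega}\infty}F(x)$ is the set of $w$ such that for every sequence $x_k\in\Omega$ with $\|\pi_I(x_k)\|\to\infty$ there exist $w_k\in F(x_k)$ with $w_k\to w$. $\mathop{\mathrm{Lim\,sup}}_{\pi_I(x)\xrightarrow{\Omega}\infty}F(x)$ is the set of $v$ such that there exist a sequence $x_k\in\Omega$ with $\|\pi_I(x_k)\|\to\infty$ and $v_k\in F(x_k)$ with $v_k\to v$. Tangent cone at infinity: $T(\infty_I;\Omega)$ is the set of $w\in\mathbb{R}^n$ such that for all sequences $x_k\in\Omega$ with $\|\pi_I(x_k)\|\to\infty$ and all $t_k>0$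 with $t_k\to 0$ there exist $w_k\to w$ with $x_k+t_kw_k\in\Omega$ for all $k$. Normal cone at infinity: $N(\infty_I;\Omega)=\{v\mid\langle v,w\rangle\le 0\ \forall w\in T(\infty_I;\Omega)\}$. Limiting normal cone at infinity: $N^M(\infty_I;\Omega)=\mathop{\mathrm{Lim\,sup}}_{\pi_I(x)\xrightarrow{\Omega}\infty}N(x;\Omega)$. *)

theory Defs
  imports "HOL-Analysis.Analysis"
begin

(* The coordinate projection onto R^I.  The target R^I is identified with the coordinate
   subspace of R^n of vectors vanishing outside I; this identification is a linear isometry,
   so norms and boundedness are those of R^I. *)
definition coord_proj :: "'n set \<Rightarrow> real ^ 'n \<Rightarrow> real ^ 'n" where
  "coord_proj I x = (\<chi> i. if i \<in> I then x $ i else 0)"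

definition seq_to_infinity :: "'n::finite set \<Rightarrow> (real ^ 'n) set \<Rightarrow> (nat \<Rightarrow> real ^ 'n) \<Rightarrow> bool" where
  "seq_to_infinity I \<Omega> x \<longleftrightarrow>
     (\<forall>k. x k \<in> \<Omega>) \<and> filterlim (\<lambda>k. norm (coord_proj I (x k))) at_top sequentially"

definition Lim_inf_infinity ::
    "'n::finite set \<Rightarrow> (real ^ 'n) set \<Rightarrow> (real ^ 'n \<Rightarrow> (real ^ 'n) set) \<Rightarrow> (real ^ 'n) set" where
  "Lim_inf_infinity I \<Omega> F =
     {w. \<forall>x. seq_to_infinity I \<Omega> x \<longrightarrow> (\<exists>u. (\<forall>k. u k \<in> F (x k)) \<and> u \<longlonglongrightarrow> w)}"

definition Lim_sup_infinity ::
    "'n::finite set \<Rightarrow> (real ^ 'n) set \<Rightarrow> (real ^ 'n \<Rightarrow> (real ^ 'n) set) \<Rightarrow> (real ^ 'n) set" where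
  "Lim_sup_infinity I \<Omega> F =
     {v. \<exists>x u. seq_to_infinity I \<Omega> x \<and> (\<forall>k. u k \<in> F (x k)) \<and> u \<longlonglongrightarrow> v}"

(* The convex-analysis formulas; they are meant for convex S and x in S. *)
definition tangent_cone :: "(real ^ 'n::finite) set \<Rightarrow> real ^ 'n \<Rightarrow> (real ^ 'n) set" where
  "tangent_cone S x = closure {c *\<^sub>R (y - x) | c y. c \<ge> 0 \<and> y \<in> S}"

definition normal_cone :: "(real ^ 'n::finite) set \<Rightarrow> real ^ 'n \<Rightarrow> (real ^ 'n) set" where
  "normal_cone S x = {v. \<forall>y\<in>S. v \<bullet> (y - x) \<le> 0}"

definition tangent_cone_infinity :: "'n::finite set \<Rightarrow> (real ^ 'n) set \<Rightarrow> (real ^ 'n) set" where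
  "tangent_cone_infinity I \<Omega> =
     {w. \<forall>x t. seq_to_infinity I \<Omega> x \<and> (\<forall>k. t k > (0::real)) \<and> t \<longlonglongrightarrow> 0 \<longrightarrow>
           (\<exists>u. u \<longlonglongrightarrow> w \<and> (\<forall>k. x k + t k *\<^sub>R u k \<in> \<Omega>))}"

definition normal_cone_infinity :: "'n::finite set \<Rightarrow> (real ^ 'n) set \<Rightarrow> (real ^ 'n) set" where
  "normal_cone_infinity I \<Omega> = {v. \<forall>w\<in>tangent_cone_infinity I \<Omega>. v \<bullet> w \<le> 0}"

definition limiting_normal_cone_infinity :: "'n::finite set \<Rightarrow> (real ^ 'n) set \<Rightarrow> (real ^ 'n) set" where
  "limiting_normal_cone_infinity I \<Omega> = Lim_sup_infinity I \<Omega> (normal_cone \<Omega>)"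

end

theory Submission
  imports Defs
begin

text \<open>
  The substantial inclusion is \<open>\<supseteq>\<close> in (i). Given \<open>x\<^sub>k\<close> and \<open>t\<^sub>k\<close>, let \<open>p\<^sub>k\<close> be the projection of
  \<open>x\<^sub>k + t\<^sub>k w\<close> onto \<open>\<Omega>\<close> and \<open>d\<^sub>k = x\<^sub>k + t\<^sub>k w - p\<^sub>k\<close>, a normal vector at \<open>p\<^sub>k\<close>. The points \<open>p\<^sub>k\<close> stay
  at bounded distance from \<open>x\<^sub>k\<close>, so they go to infinity as well and the hypothesis yields tangent
  vectors \<open>u\<^sub>k \<in> T(p\<^sub>k; \<Omega>)\<close> with \<open>u\<^sub>k \<longlonglongrightarrow> w\<close>. Normality of \<open>d\<^sub>k\<close> gives
  \<open>\<parallel>d\<^sub>k\<parallel>\<^sup>2 \<le> t\<^sub>k (d\<^sub>k \<bullet> w) \<le> t\<^sub>k (d\<^sub>k \<bullet> (w - u\<^sub>k))\<close>, hence \<open>\<parallel>d\<^sub>k\<parallel> / t\<^sub>k \<le> \<parallel>w - u\<^sub>k\<parallel> \<longlonglongrightarrow> 0\<close>.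
\<close>

lemma coord_proj_diff: "coord_proj I (x - y) = coord_proj I x - coord_proj I y"
  by (simp add: coord_proj_def vec_eq_iff)

lemma norm_coord_proj_le: "norm (coord_proj I x) \<le> norm (x :: real ^ 'n::finite)"
  by (rule norm_le_componentwise_cart) (simp add: coord_proj_def)

text \<open>\<open>coord_proj I\<close> is linear and does not increase norms, so replacing
  \<open>x k\<close> by \<open>p k\<close> lowers the norm of the projection by at most
  \<open>B\<close>.\<close>

lemma seq_to_infinity_bounded_perturbation:
  assumes x: "seq_to_infinity I \<Omega> x" and p: "\<And>k. p k \<in> \<Omega>"
    and bound: "\<And>k. norm (x k - p k) \<le> B"
  shows "seq_to_infinity I \<Omega> p"
proof -
  have "filterlim (\<lambda>k. - B + norm (coord_proj I (x k))) at_top sequentially"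
    using x unfolding seq_to_infinity_def
    by (intro filterlim_tendsto_add_at_top[OF tendsto_const]) auto
  then have "filterlim (\<lambda>k. norm (coord_proj I (p k))) at_top sequentially"
  proof (rule filterlim_at_top_mono, intro always_eventually allI)
    fix k
    have "norm (coord_proj I (x k)) \<le> norm (coord_proj I (p k)) + norm (coord_proj I (x k - p k))"
      unfolding coord_proj_diff by (rule norm_triangle_sub)
    also have "norm (coord_proj I (x k - p k)) \<le> B"
      using norm_coord_proj_le bound order_trans by blast
    finally show "- B + norm (coord_proj I (x k)) \<le> norm (coord_proj I (p k))" by simp
  qed
  with p show ?thesis by (simp add: seq_to_infinity_def)
qed

text \<open>The inequality is immediate on the generators \<open>c *\<^sub>R (y - x)\<close>; it
  survives the closure because a half-space is closed.\<close>

lemma inner_normal_tangent_nonpos: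
  assumes "v \<in> normal_cone S x" and "u \<in> tangent_cone S x"
  shows "v \<bullet> u \<le> 0"
proof -
  have "tangent_cone S x \<subseteq> {u. v \<bullet> u \<le> 0}"
    unfolding tangent_cone_def using assms(1)
    by (intro closure_minimal closed_halfspace_le)
      (auto simp: normal_cone_def mult_nonneg_nonpos)
  with assms(2) show ?thesis by blast
qed

lemma tangent_coneI_step:
  assumes "t > 0" and "x + t *\<^sub>R u \<in> S"
  shows "u \<in> tangent_cone S x"
proof -
  have "u = (1 / t) *\<^sub>R ((x + t *\<^sub>R u) - x)" using assms(1) by simp
  moreover have "1 / t \<ge> 0" using assms(1) by simp
  ultimately have "u \<in> {c *\<^sub>R (y - x) | c y. c \<ge> 0 \<and> y \<in> S}" using assms(2) by blast
  then show ?thesis unfolding tangent_cone_def by (rule subsetD[OF closure_subset])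
qed

lemma diff_closest_point_in_normal_cone:
  assumes "closed S" and "convex S"
  shows "z - closest_point S z \<in> normal_cone S (closest_point S z)"
  using closest_point_dot[OF assms(2,1)] by (auto simp: normal_cone_def)

lemma norm_diff_closest_point_le:
  fixes S :: "(real ^ 'n::finite) set"
  assumes S: "closed S" "convex S" and x: "x \<in> S" and "t \<ge> 0"
    and u: "u \<in> tangent_cone S (closest_point S (x + t *\<^sub>R w))"
  shows "norm (x + t *\<^sub>R w - closest_point S (x + t *\<^sub>R w)) \<le> t * norm (w - u)"
proof -
  define p where "p = closest_point S (x + t *\<^sub>R w)"
  define d where "d = x + t *\<^sub>R w - p"
  have d: "d \<in> normal_cone S p"
    unfolding d_def p_def by (rule diff_closest_point_in_normal_cone[OF S])
  have "d \<bullet> (x - p) \<le> 0" using d x by (simp add: normal_cone_def)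
  moreover have "t * (d \<bullet> u) \<le> 0"
    using inner_normal_tangent_nonpos[OF d] u \<open>t \<ge> 0\<close> by (simp add: p_def mult_nonneg_nonpos)
  \<comment> \<open>Splitting \<open>d\<close> as
    \<open>(x - p) + t *\<^sub>R (w - u) + t *\<^sub>R u\<close> leaves the middle term as the only
    one that can be positive.\<close>
  moreover have "d \<bullet> d = d \<bullet> (x - p) + t * (d \<bullet> (w - u)) + t * (d \<bullet> u)"
  proof -
    have "d \<bullet> d = d \<bullet> ((x - p) + t *\<^sub>R (w - u) + t *\<^sub>R u)"
      by (simp add: d_def algebra_simps)
    then show ?thesis by (simp add: inner_add_right)
  qed
  ultimately have "norm d * norm d \<le> t * (d \<bullet> (w - u))"
    by (simp add: power2_eq_square flip: power2_norm_eq_inner)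
  also have "\<dots> \<le> t * (norm d * norm (w - u))"
    using \<open>t \<ge> 0\<close> by (intro mult_left_mono norm_cauchy_schwarz)
  finally have "norm d * norm d \<le> norm d * (t * norm (w - u))" by (simp add: mult_ac)
  then have "norm d \<le> t * norm (w - u)"
    using \<open>t \<ge> 0\<close> by (cases "d = 0") (auto simp: mult_le_cancel_left)
  then show ?thesis by (simp add: d_def p_def)
qed

lemma tangent_cone_infinity_subset:
  "tangent_cone_infinity I \<Omega> \<subseteq> Lim_inf_infinity I \<Omega> (tangent_cone \<Omega>)"
proof
  fix w assume w: "w \<in> tangent_cone_infinity I \<Omega>"
  have "\<exists>u. (\<forall>k. u k \<in> tangent_cone \<Omega> (x k)) \<and> u \<longlonglongrightarrow> w" if x: "seq_to_infinity I \<Omega> x" for x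
  proof -
    \<comment> \<open>Any positive null sequence would do: the steps it produces already exhibit
      \<open>u k\<close> as tangent vectors.\<close>
    define t where "t k = inverse (real (Suc k))" for k
    have t: "t k > 0" for k by (simp add: t_def)
    have "t \<longlonglongrightarrow> 0" unfolding t_def by (rule LIMSEQ_inverse_real_of_nat)
    with w x t obtain u where u: "u \<longlonglongrightarrow> w" "\<And>k. x k + t k *\<^sub>R u k \<in> \<Omega>"
      unfolding tangent_cone_infinity_def by blast
    have "u k \<in> tangent_cone \<Omega> (x k)" for k using t u(2) by (rule tangent_coneI_step)
    with u(1) show ?thesis by blast
  qed
  then show "w \<in> Lim_inf_infinity I \<Omega> (tangent_cone \<Omega>)" by (simp add: Lim_inf_infinity_def)
qed

lemma Lim_inf_tangent_cone_subset:
  fixes \<Omega> :: "(real ^ 'n::finite) set"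
  assumes \<Omega>: "closed \<Omega>" "convex \<Omega>"
  shows "Lim_inf_infinity I \<Omega> (tangent_cone \<Omega>) \<subseteq> tangent_cone_infinity I \<Omega>"
proof
  fix w assume w: "w \<in> Lim_inf_infinity I \<Omega> (tangent_cone \<Omega>)"
  have "\<exists>v. v \<longlonglongrightarrow> w \<and> (\<forall>k. x k + t k *\<^sub>R v k \<in> \<Omega>)"
    if x: "seq_to_infinity I \<Omega> x" and t: "\<And>k. t k > 0" "t \<longlonglongrightarrow> 0" for x t
  proof -
    define p where "p k = closest_point \<Omega> (x k + t k *\<^sub>R w)" for k
    have x_in: "x k \<in> \<Omega>" for k using x by (simp add: seq_to_infinity_def)
    have p_in: "p k \<in> \<Omega>" for k
      unfolding p_def using closest_point_in_set[OF \<Omega>(1)] x_in by blast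
    have "Bseq t" using t(2) by (intro convergent_imp_Bseq convergentI)
    then obtain B where B: "\<And>k. norm (t k) \<le> B" unfolding Bseq_def by blast
    \<comment> \<open>Each \<open>x k\<close> is its own projection and projecting is nonexpansive,
      so \<open>p k\<close> is no farther from \<open>x k\<close> than the step
      \<open>t k *\<^sub>R w\<close> is long.\<close>
    have "norm (x k - p k) \<le> B * norm w" for k
    proof -
      have "norm (x k - p k) = dist (closest_point \<Omega> (x k)) (closest_point \<Omega> (x k + t k *\<^sub>R w))"
        by (simp add: p_def dist_norm closest_point_self[OF x_in])
      also have "\<dots> \<le> dist (x k) (x k + t k *\<^sub>R w)"
        using x_in by (intro closest_point_lipschitz \<Omega>) auto
      also have "\<dots> = norm (t k) * norm w" by (simp add: dist_norm)
      also have "\<dots> \<le> B * norm w" using B by (intro mult_right_mono) auto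
      finally show ?thesis .
    qed
    then have "seq_to_infinity I \<Omega> p" by (intro seq_to_infinity_bounded_perturbation[OF x p_in])
    with w obtain u where u: "\<And>k. u k \<in> tangent_cone \<Omega> (p k)" and u_lim: "u \<longlonglongrightarrow> w"
      unfolding Lim_inf_infinity_def by blast
    \<comment> \<open>This choice makes \<open>x k + t k *\<^sub>R v k\<close> equal to
      \<open>p k\<close>, and \<open>v k - w\<close> is the projection residual divided by
      \<open>- t k\<close>.\<close>
    define v where "v k = (1 / t k) *\<^sub>R (p k - x k)" for k
    have t_v: "t k *\<^sub>R v k = p k - x k" for k using t(1)[of k] by (simp add: v_def)
    have "norm (v k - w) \<le> norm (w - u k)" for k
    proof -
      have "t k * norm (v k - w) = norm (t k *\<^sub>R (v k - w))" using t(1)[of k] by simp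
      also have "t k *\<^sub>R (v k - w) = - (x k + t k *\<^sub>R w - p k)"
        by (simp add: scaleR_diff_right t_v)
      also have "norm \<dots> \<le> t k * norm (w - u k)"
        using norm_diff_closest_point_le[OF \<Omega> x_in] u t(1)[of k]
        unfolding p_def norm_minus_cancel by simp
      finally show ?thesis using t(1)[of k] by simp
    qed
    moreover have "(\<lambda>k. norm (w - u k)) \<longlonglongrightarrow> 0"
      using u_lim by (auto intro!: tendsto_eq_intros)
    ultimately have "(\<lambda>k. v k - w) \<longlonglongrightarrow> 0"
      by (rule Lim_null_comparison[OF always_eventually[OF allI]])
    then have "v \<longlonglongrightarrow> w" by (simp add: LIM_zero_iff)
    then show ?thesis using t_v p_in by (intro exI[of _ v]) simp
  qed
  then show "w \<in> tangent_cone_infinity I \<Omega>" by (simp add: tangent_cone_infinity_def)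
qed

text \<open>Along the sequence that defines \<open>v\<close>, the vector \<open>w\<close> is a limit
  of tangent vectors at the same points; the sign of the normal-tangent pairing passes to the
  limit.\<close>

lemma limiting_normal_cone_infinity_subset:
  "limiting_normal_cone_infinity I \<Omega> \<subseteq> normal_cone_infinity I \<Omega>"
proof
  fix v assume "v \<in> limiting_normal_cone_infinity I \<Omega>"
  then obtain x n where x: "seq_to_infinity I \<Omega> x"
    and n: "\<And>k. n k \<in> normal_cone \<Omega> (x k)" "n \<longlonglongrightarrow> v"
    unfolding limiting_normal_cone_infinity_def Lim_sup_infinity_def by blast
  have "v \<bullet> w \<le> 0" if "w \<in> tangent_cone_infinity I \<Omega>" for w
  proof -
    have "w \<in> Lim_inf_infinity I \<Omega> (tangent_cone \<Omega>)"
      using tangent_cone_infinity_subset that by (rule subsetD)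
    then obtain u where u: "\<And>k. u k \<in> tangent_cone \<Omega> (x k)" "u \<longlonglongrightarrow> w"
      using x unfolding Lim_inf_infinity_def by blast
    show ?thesis
    proof (rule LIMSEQ_le_const2)
      show "(\<lambda>k. n k \<bullet> u k) \<longlonglongrightarrow> v \<bullet> w" using n(2) u(2) by (rule tendsto_inner)
      show "\<exists>N. \<forall>k\<ge>N. n k \<bullet> u k \<le> 0"
        using inner_normal_tangent_nonpos[OF n(1) u(1)] by simp
    qed
  qed
  then show "v \<in> normal_cone_infinity I \<Omega>" by (simp add: normal_cone_infinity_def)
qed

theorem proposition3p2:
  fixes \<Omega> :: "(real ^ 'n::finite) set" and I :: "'n set"
  assumes "\<Omega> \<noteq> {}" and "closed \<Omega>" and "convex \<Omega>"
    and "I \<noteq> {}"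
    and "\<not> bounded (coord_proj I ` \<Omega>)"
  shows "tangent_cone_infinity I \<Omega> = Lim_inf_infinity I \<Omega> (tangent_cone \<Omega>) \<and>
         limiting_normal_cone_infinity I \<Omega> \<subseteq> normal_cone_infinity I \<Omega>"
  using tangent_cone_infinity_subset Lim_inf_tangent_cone_subset[OF assms(2,3)]
    limiting_normal_cone_infinity_subset by blast

end
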